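(* There is a constant $K_0$, depending only on $\Phi_0$, such that for every regularity threshold $K\ge K_0$ the following holds. Let $x<y=wt_{v\lambda}$ in $W$, with $w,v\in W_0$ and $\lambda\in Q^\vee$ antidominant, and let $$x\xrightarrow{\beta_k}z_{k-1}\xrightarrow{\beta_{k-1}}\cdots\xrightarrow{\beta_2}z_1\xrightarrow{\beta_1}y$$ be a superregular saturated chain with labels $\beta_1,\dots,\beta_k\in\Phi_0^+$. Let $f_1<\dots<f_i$ be the indices of the far coverings and $n_1<\dots<n_j$ the indices of the near coverings, and put $r_f=r_{\beta_{f_1}}r_{\beta_{f_2}}\cdots r_{\beta_{f_i}}$, $r_n=r_{\beta_{n_1}}r_{\beta_{n_2}}\cdots r_{\beta_{n_j}}$. Then there exist well-defined directed paths $P_f$ from $vr_f$ to $v$ and $P_n$ from $wv$ to $wvr_n$ in the quantum Bruhat graph $\Gamma$, namely $P_n$ formed by the edges corresponding to the near coverings, traversed in the order $n_1,n_2,\dots,n_j$, and $P_f$ formed by the edges corresponding to the far coverings, traversed in the order $f_i,\dots,f_2,f_1$, such that $$x=wvr_n(vr_f)^{-1}\,t_{vr_f(\lambda+\mathrm{wt}(P_n)+\mathrm{wt}(P_f))}.$$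
   Context: $\Phi_0$ is an irreducible reduced crystallographic finite root system with simple roots $\alpha_i$ ($i\in I_0$), positive roots $\Phi_0^+$, coroots $\alpha^\vee$, coroot lattice $Q^\vee$, pairing $\langle\cdot,\cdot\rangle$ between coroots and roots, finite Weyl group $W_0$, reflections $r_\alpha\in W_0$, and $\rho=\frac12\sum_{\alpha\in\Phi_0^+}\alpha$. $W=W_0\ltimes Q^\vee$ is the associated affine Weyl group (untwisted affine type); $t_\lambda\in W$ denotes translation by $\lambda\in Q^\vee$, with $wt_\lambda w^{-1}=t_{w\lambda}$ for $w\in W_0$. $W$ is a Coxeter group with generators $s_i=r_{\alpha_i}$ ($i\in I_0$) and $s_0=t_{\theta^\vee}r_\theta$, $\theta$ the highest root; $\ell$ is its length function, $\le$ its Bruhat order and $\lessdot$ the covering relation. The quantum Bruhat graph $\Gamma$ is the directed graph with vertex set $W_0$ and a directed edge $w\to wr_\alpha$ (labeled $\alpha$) for each $(w,\alpha)\in W_0\times\Phi_0^+$ such that either $\ell(wr_\alpha)=\ell(w)+1$ (Bruhat edge, of weight $0$) or $\ell(wr_\alpha)=\ell(w)-\langle\alpha^\vee,2\rho\rangle+1$ (quantum edge, of weight $\alpha^\vee$). The weight $\mathrm{wt}(P)$ of a directed path $P$ is the sum of the weights of its edges; trivial (length $0$) paths have weight $0$. Regularity: $\lambda\in Q^\vee$ is antidominant if $\langle\lambda,\alpha_i\rangle\le0$ for all $i\in I_0$. Fix a threshold $K$. An antidominant $\lambda$ is sufficiently regular if $|\langle\lambda,\alpha_i\rangle|\ge K$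 for all $i\in I_0$, and $z\in W$ is sufficiently regular if $z=wt_{v\lambda}$ with $w,v\in W_0$ and $\lambda$ antidominant and sufficiently regular. An element $y$ is superregular with respect to $x$ if for every saturated chain $x\lessdot z_{k-1}\lessdot\dots\lessdot z_1\lessdot y$ in $W$, the elements $y,z_1,\dots,z_{k-1}$ are all sufficiently regular. A saturated chain is superregular if its top element is superregular with respect to its bottom element. Near and far coverings: it is known (Lam–Shimozono) that if $K$ is large enough and $z=wt_{v\lambda}$ with $w,v\in W_0$, $\lambda$ antidominant and sufficiently regular, then for every covering $z'\lessdot z$ there is a unique $\alpha\in\Phi_0^+$, the label of the covering, such that exactly one of the following holds: (near covering) $wv\to wvr_\alpha$ is an edge $E$ of $\Gamma$ and $z'=wr_{v\alpha}t_{v(\lambda+\mathrm{wt}(E))}$; (far covering) $vr_\alpha\to v$ is an edge $E$ of $\Gamma$ and $z'=wr_{v\alpha}t_{vr_\alpha(\lambda+\mathrm{wt}(E))}$. The edge $E$ is the edge corresponding to the covering. In the chain, $\beta_m$ is the label of the $m$-th covering from the top ($z_m\lessdot z_{m-1}$, with $z_0=y$, $z_k=x$). *)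

theory Defs
  imports "HOL-Analysis.Analysis" "Graph_Theory.Arc_Walk"
begin

section \<open>Finite root systems\<close>

text \<open>
  Roots and coroots live in the same Euclidean space: the coroot of \<open>\<alpha>\<close> is
  \<open>2\<alpha> / (\<alpha>, \<alpha>)\<close>, and the pairing of a coroot lattice vector with a root is the inner product.
\<close>

definition coroot :: "'a::euclidean_space \<Rightarrow> 'a" where
  "coroot \<alpha> = (2 / (\<alpha> \<bullet> \<alpha>)) *\<^sub>R \<alpha>"

definition root_refl :: "'a::euclidean_space \<Rightarrow> 'a \<Rightarrow> 'a" where
  "root_refl \<alpha> x = x - (x \<bullet> \<alpha>) *\<^sub>R coroot \<alpha>"

definition root_system :: "'a::euclidean_space set \<Rightarrow> bool" where
  "root_system \<Phi> \<longleftrightarrow>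
     finite \<Phi> \<and> 0 \<notin> \<Phi> \<and> span \<Phi> = UNIV \<and> (\<forall>\<alpha>\<in>\<Phi>. root_refl \<alpha> ` \<Phi> = \<Phi>)"

definition crystallographic :: "'a::euclidean_space set \<Rightarrow> bool" where
  "crystallographic \<Phi> \<longleftrightarrow> (\<forall>\<alpha>\<in>\<Phi>. \<forall>\<beta>\<in>\<Phi>. coroot \<alpha> \<bullet> \<beta> \<in> \<int>)"

definition reduced_roots :: "'a::euclidean_space set \<Rightarrow> bool" where
  "reduced_roots \<Phi> \<longleftrightarrow> (\<forall>\<alpha>\<in>\<Phi>. \<forall>c. c *\<^sub>R \<alpha> \<in> \<Phi> \<longrightarrow> c = 1 \<or> c = -1)"

definition irreducible_roots :: "'a::euclidean_space set \<Rightarrow> bool" where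
  "irreducible_roots \<Phi> \<longleftrightarrow> \<Phi> \<noteq> {} \<and>
     (\<nexists>\<Phi>\<^sub>1 \<Phi>\<^sub>2. \<Phi>\<^sub>1 \<noteq> {} \<and> \<Phi>\<^sub>2 \<noteq> {} \<and> \<Phi>\<^sub>1 \<union> \<Phi>\<^sub>2 = \<Phi> \<and> (\<forall>\<alpha>\<in>\<Phi>\<^sub>1. \<forall>\<beta>\<in>\<Phi>\<^sub>2. \<alpha> \<bullet> \<beta> = 0))"

definition nonneg_comb :: "'a::euclidean_space set \<Rightarrow> 'a \<Rightarrow> bool" where
  "nonneg_comb \<Delta> x \<longleftrightarrow> (\<exists>c :: 'a \<Rightarrow> nat. x = (\<Sum>\<alpha>\<in>\<Delta>. real (c \<alpha>) *\<^sub>R \<alpha>))"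

definition simple_roots :: "'a::euclidean_space set \<Rightarrow> 'a set \<Rightarrow> bool" where
  "simple_roots \<Phi> \<Delta> \<longleftrightarrow>
     \<Delta> \<subseteq> \<Phi> \<and> independent \<Delta> \<and> (\<forall>\<beta>\<in>\<Phi>. nonneg_comb \<Delta> \<beta> \<or> nonneg_comb \<Delta> (- \<beta>))"

definition pos_roots :: "'a::euclidean_space set \<Rightarrow> 'a set \<Rightarrow> 'a set" where
  "pos_roots \<Phi> \<Delta> = {\<beta> \<in> \<Phi>. nonneg_comb \<Delta> \<beta>}"

definition highest_root :: "'a::euclidean_space set \<Rightarrow> 'a set \<Rightarrow> 'a" where
  "highest_root \<Phi> \<Delta> = (THE \<theta>. \<theta> \<in> \<Phi> \<and> (\<forall>\<beta>\<in>\<Phi>. nonneg_comb \<Delta> (\<theta> - \<beta>)))"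

definition rho :: "'a::euclidean_space set \<Rightarrow> 'a set \<Rightarrow> 'a" where
  "rho \<Phi> \<Delta> = (1 / 2) *\<^sub>R (\<Sum>\<alpha>\<in>pos_roots \<Phi> \<Delta>. \<alpha>)"

definition coroot_lattice :: "'a::euclidean_space set \<Rightarrow> 'a set" where
  "coroot_lattice \<Phi> = {\<Sum>\<alpha>\<in>\<Phi>. real_of_int (c \<alpha>) *\<^sub>R coroot \<alpha> | c. True}"

section \<open>Finite and affine Weyl groups\<close>

text \<open>
  All group elements are realised as transformations of the ambient space; multiplication is
  composition of maps. An element \<open>w t\<^sub>\<lambda>\<close> of \<open>W\<^sub>0 \<ltimes> Q\<^sup>\<or>\<close> is the affine map
  \<open>x \<mapsto> w (x + \<lambda>)\<close>. This representation is faithful and satisfies \<open>w t\<^sub>\<lambda> w\<^sup>-\<^sup>1 = t\<^sub>w\<^sub>\<lambda>\<close>.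
\<close>

definition comp_list :: "('a \<Rightarrow> 'a) list \<Rightarrow> 'a \<Rightarrow> 'a" where
  "comp_list gs = foldr (\<circ>) gs id"

definition finite_weyl :: "'a::euclidean_space set \<Rightarrow> ('a \<Rightarrow> 'a) set" where
  "finite_weyl \<Phi> = {comp_list gs | gs. set gs \<subseteq> root_refl ` \<Phi>}"

definition transl :: "'a::euclidean_space \<Rightarrow> 'a \<Rightarrow> 'a" where
  "transl \<mu> x = x + \<mu>"

definition affine_weyl :: "'a::euclidean_space set \<Rightarrow> ('a \<Rightarrow> 'a) set" where
  "affine_weyl \<Phi> = {w \<circ> transl \<mu> | w \<mu>. w \<in> finite_weyl \<Phi> \<and> \<mu> \<in> coroot_lattice \<Phi>}"

definition affine_gens :: "'a::euclidean_space set \<Rightarrow> 'a set \<Rightarrow> ('a \<Rightarrow> 'a) set" where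
  "affine_gens \<Phi> \<Delta> =
     insert (transl (coroot (highest_root \<Phi> \<Delta>)) \<circ> root_refl (highest_root \<Phi> \<Delta>)) (root_refl ` \<Delta>)"

text \<open>
  Coxeter length on the affine Weyl group. It is also used on the finite Weyl group, a standard
  parabolic subgroup, where it agrees with the length in the simple reflections.
\<close>

definition len :: "'a::euclidean_space set \<Rightarrow> 'a set \<Rightarrow> ('a \<Rightarrow> 'a) \<Rightarrow> nat" where
  "len \<Phi> \<Delta> g =
     (LEAST n. \<exists>gs. length gs = n \<and> set gs \<subseteq> affine_gens \<Phi> \<Delta> \<and> comp_list gs = g)"

definition affine_refls :: "'a::euclidean_space set \<Rightarrow> 'a set \<Rightarrow> ('a \<Rightarrow> 'a) set" where
  "affine_refls \<Phi> \<Delta> = {u \<circ> s \<circ> inv u | u s. u \<in> affine_weyl \<Phi> \<and> s \<in> affine_gens \<Phi> \<Delta>}"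

definition bruhat_step ::
  "'a::euclidean_space set \<Rightarrow> 'a set \<Rightarrow> ('a \<Rightarrow> 'a) \<Rightarrow> ('a \<Rightarrow> 'a) \<Rightarrow> bool" where
  "bruhat_step \<Phi> \<Delta> x y \<longleftrightarrow> x \<in> affine_weyl \<Phi> \<and> y \<in> affine_weyl \<Phi> \<and>
     (\<exists>t\<in>affine_refls \<Phi> \<Delta>. y = x \<circ> t) \<and> len \<Phi> \<Delta> x < len \<Phi> \<Delta> y"

definition bruhat_less ::
  "'a::euclidean_space set \<Rightarrow> 'a set \<Rightarrow> ('a \<Rightarrow> 'a) \<Rightarrow> ('a \<Rightarrow> 'a) \<Rightarrow> bool" where
  "bruhat_less \<Phi> \<Delta> = (bruhat_step \<Phi> \<Delta>)\<^sup>+\<^sup>+"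

definition bruhat_cover ::
  "'a::euclidean_space set \<Rightarrow> 'a set \<Rightarrow> ('a \<Rightarrow> 'a) \<Rightarrow> ('a \<Rightarrow> 'a) \<Rightarrow> bool" where
  "bruhat_cover \<Phi> \<Delta> x y \<longleftrightarrow> bruhat_less \<Phi> \<Delta> x y \<and>
     (\<nexists>z. bruhat_less \<Phi> \<Delta> x z \<and> bruhat_less \<Phi> \<Delta> z y)"

text \<open>Saturated chains are numbered from the top: \<open>z 0 = y\<close> and \<open>z k = x\<close>.\<close>

definition saturated_chain ::
  "'a::euclidean_space set \<Rightarrow> 'a set \<Rightarrow> nat \<Rightarrow> (nat \<Rightarrow> 'a \<Rightarrow> 'a) \<Rightarrow> ('a \<Rightarrow> 'a) \<Rightarrow> ('a \<Rightarrow> 'a) \<Rightarrow> bool"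
  where
  "saturated_chain \<Phi> \<Delta> k z x y \<longleftrightarrow>
     z 0 = y \<and> z k = x \<and> (\<forall>m\<in>{1..k}. bruhat_cover \<Phi> \<Delta> (z m) (z (m - 1)))"

section \<open>The quantum Bruhat graph\<close>

text \<open>The edge with source \<open>w\<close> and label \<open>\<alpha>\<close> is encoded as the pair \<open>(w, \<alpha>)\<close>.\<close>

type_synonym 'a qedge = "('a \<Rightarrow> 'a) \<times> 'a"

definition bruhat_edge :: "'a::euclidean_space set \<Rightarrow> 'a set \<Rightarrow> 'a qedge \<Rightarrow> bool" where
  "bruhat_edge \<Phi> \<Delta> = (\<lambda>(w, \<alpha>). len \<Phi> \<Delta> (w \<circ> root_refl \<alpha>) = len \<Phi> \<Delta> w + 1)"

definition quantum_edge :: "'a::euclidean_space set \<Rightarrow> 'a set \<Rightarrow> 'a qedge \<Rightarrow> bool" where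
  "quantum_edge \<Phi> \<Delta> = (\<lambda>(w, \<alpha>).
     real (len \<Phi> \<Delta> (w \<circ> root_refl \<alpha>)) = real (len \<Phi> \<Delta> w) - coroot \<alpha> \<bullet> (2 *\<^sub>R rho \<Phi> \<Delta>) + 1)"

definition qbg :: "'a::euclidean_space set \<Rightarrow> 'a set \<Rightarrow> ('a \<Rightarrow> 'a, 'a qedge) pre_digraph" where
  "qbg \<Phi> \<Delta> = \<lparr>verts = finite_weyl \<Phi>,
     arcs = {e \<in> finite_weyl \<Phi> \<times> pos_roots \<Phi> \<Delta>. bruhat_edge \<Phi> \<Delta> e \<or> quantum_edge \<Phi> \<Delta> e},
     tail = fst, head = (\<lambda>(w, \<alpha>). w \<circ> root_refl \<alpha>)\<rparr>"

text \<open>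
  No edge is both a Bruhat and a quantum edge, since \<open>(\<alpha>\<^sup>\<or>, 2\<rho>) > 0\<close> for positive \<open>\<alpha>\<close>.
\<close>

definition edge_weight :: "'a::euclidean_space set \<Rightarrow> 'a set \<Rightarrow> 'a qedge \<Rightarrow> 'a" where
  "edge_weight \<Phi> \<Delta> e = (if bruhat_edge \<Phi> \<Delta> e then 0 else coroot (snd e))"

definition path_weight :: "'a::euclidean_space set \<Rightarrow> 'a set \<Rightarrow> 'a qedge list \<Rightarrow> 'a" where
  "path_weight \<Phi> \<Delta> p = sum_list (map (edge_weight \<Phi> \<Delta>) p)"

section \<open>Regularity, near and far coverings\<close>

definition antidominant :: "'a::euclidean_space set \<Rightarrow> 'a \<Rightarrow> bool" where
  "antidominant \<Delta> \<mu> \<longleftrightarrow> (\<forall>\<alpha>\<in>\<Delta>. \<mu> \<bullet> \<alpha> \<le> 0)"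

definition suff_regular :: "'a::euclidean_space set \<Rightarrow> real \<Rightarrow> 'a \<Rightarrow> bool" where
  "suff_regular \<Delta> K \<mu> \<longleftrightarrow> (\<forall>\<alpha>\<in>\<Delta>. \<bar>\<mu> \<bullet> \<alpha>\<bar> \<ge> K)"

definition regular_presentation ::
  "'a::euclidean_space set \<Rightarrow> 'a set \<Rightarrow> real \<Rightarrow> ('a \<Rightarrow> 'a) \<Rightarrow> ('a \<Rightarrow> 'a) \<Rightarrow> ('a \<Rightarrow> 'a) \<Rightarrow> 'a \<Rightarrow> bool"
  where
  "regular_presentation \<Phi> \<Delta> K z w v \<mu> \<longleftrightarrow>
     w \<in> finite_weyl \<Phi> \<and> v \<in> finite_weyl \<Phi> \<and> \<mu> \<in> coroot_lattice \<Phi> \<and>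
     antidominant \<Delta> \<mu> \<and> suff_regular \<Delta> K \<mu> \<and> z = w \<circ> transl (v \<mu>)"

definition suff_regular_elt ::
  "'a::euclidean_space set \<Rightarrow> 'a set \<Rightarrow> real \<Rightarrow> ('a \<Rightarrow> 'a) \<Rightarrow> bool" where
  "suff_regular_elt \<Phi> \<Delta> K z \<longleftrightarrow> (\<exists>w v \<mu>. regular_presentation \<Phi> \<Delta> K z w v \<mu>)"

definition superregular ::
  "'a::euclidean_space set \<Rightarrow> 'a set \<Rightarrow> real \<Rightarrow> ('a \<Rightarrow> 'a) \<Rightarrow> ('a \<Rightarrow> 'a) \<Rightarrow> bool" where
  "superregular \<Phi> \<Delta> K y x \<longleftrightarrow>
     (\<forall>k z. saturated_chain \<Phi> \<Delta> k z x y \<longrightarrow> (\<forall>m<k. suff_regular_elt \<Phi> \<Delta> K (z m)))"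

text \<open>
  \<open>near_edge \<Phi> \<Delta> K z' z \<alpha> e\<close>: \<open>z' \<lessdot> z\<close> has the shape of a near covering labelled \<open>\<alpha>\<close> with
  corresponding edge \<open>e = (w v \<rightarrow> w v r\<^sub>\<alpha>)\<close>; similarly for far coverings with
  \<open>e = (v r\<^sub>\<alpha> \<rightarrow> v)\<close>, whose source is \<open>v r\<^sub>\<alpha>\<close>. For \<open>K > 0\<close> the presentation
  \<open>z = w t\<^sub>v\<^sub>\<mu>\<close> is unique.
\<close>

definition near_edge ::
  "'a::euclidean_space set \<Rightarrow> 'a set \<Rightarrow> real \<Rightarrow> ('a \<Rightarrow> 'a) \<Rightarrow> ('a \<Rightarrow> 'a) \<Rightarrow> 'a \<Rightarrow> 'a qedge \<Rightarrow> bool"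
  where
  "near_edge \<Phi> \<Delta> K z' z \<alpha> e \<longleftrightarrow> (\<exists>w v \<mu>. regular_presentation \<Phi> \<Delta> K z w v \<mu> \<and>
     e = (w \<circ> v, \<alpha>) \<and> e \<in> arcs (qbg \<Phi> \<Delta>) \<and>
     z' = w \<circ> root_refl (v \<alpha>) \<circ> transl (v (\<mu> + edge_weight \<Phi> \<Delta> e)))"

definition far_edge ::
  "'a::euclidean_space set \<Rightarrow> 'a set \<Rightarrow> real \<Rightarrow> ('a \<Rightarrow> 'a) \<Rightarrow> ('a \<Rightarrow> 'a) \<Rightarrow> 'a \<Rightarrow> 'a qedge \<Rightarrow> bool"
  where
  "far_edge \<Phi> \<Delta> K z' z \<alpha> e \<longleftrightarrow> (\<exists>w v \<mu>. regular_presentation \<Phi> \<Delta> K z w v \<mu> \<and>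
     e = (v \<circ> root_refl \<alpha>, \<alpha>) \<and> e \<in> arcs (qbg \<Phi> \<Delta>) \<and>
     z' = w \<circ> root_refl (v \<alpha>) \<circ> transl ((v \<circ> root_refl \<alpha>) (\<mu> + edge_weight \<Phi> \<Delta> e)))"

definition near_covering ::
  "'a::euclidean_space set \<Rightarrow> 'a set \<Rightarrow> real \<Rightarrow> ('a \<Rightarrow> 'a) \<Rightarrow> ('a \<Rightarrow> 'a) \<Rightarrow> 'a \<Rightarrow> bool" where
  "near_covering \<Phi> \<Delta> K z' z \<alpha> \<longleftrightarrow> bruhat_cover \<Phi> \<Delta> z' z \<and> (\<exists>e. near_edge \<Phi> \<Delta> K z' z \<alpha> e)"

definition far_covering ::
  "'a::euclidean_space set \<Rightarrow> 'a set \<Rightarrow> real \<Rightarrow> ('a \<Rightarrow> 'a) \<Rightarrow> ('a \<Rightarrow> 'a) \<Rightarrow> 'a \<Rightarrow> bool" where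
  "far_covering \<Phi> \<Delta> K z' z \<alpha> \<longleftrightarrow> bruhat_cover \<Phi> \<Delta> z' z \<and> (\<exists>e. far_edge \<Phi> \<Delta> K z' z \<alpha> e)"

text \<open>
  The label of a covering is unique once \<open>K\<close> is large (Lam--Shimozono), so it is kept as a
  relation; the disjunction in the definition is exclusive.
\<close>

definition covering_label ::
  "'a::euclidean_space set \<Rightarrow> 'a set \<Rightarrow> real \<Rightarrow> ('a \<Rightarrow> 'a) \<Rightarrow> ('a \<Rightarrow> 'a) \<Rightarrow> 'a \<Rightarrow> bool" where
  "covering_label \<Phi> \<Delta> K z' z \<alpha> \<longleftrightarrow> \<alpha> \<in> pos_roots \<Phi> \<Delta> \<and>
     (near_covering \<Phi> \<Delta> K z' z \<alpha> \<noteq> far_covering \<Phi> \<Delta> K z' z \<alpha>)"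

text \<open>Increasing lists of the positions of the near and of the far coverings of a chain.\<close>

definition near_indices ::
  "'a::euclidean_space set \<Rightarrow> 'a set \<Rightarrow> real \<Rightarrow> nat \<Rightarrow> (nat \<Rightarrow> 'a \<Rightarrow> 'a) \<Rightarrow> (nat \<Rightarrow> 'a) \<Rightarrow> nat list"
  where
  "near_indices \<Phi> \<Delta> K k z \<beta> =
     filter (\<lambda>m. near_covering \<Phi> \<Delta> K (z m) (z (m - 1)) (\<beta> m)) [1..<k + 1]"

definition far_indices ::
  "'a::euclidean_space set \<Rightarrow> 'a set \<Rightarrow> real \<Rightarrow> nat \<Rightarrow> (nat \<Rightarrow> 'a \<Rightarrow> 'a) \<Rightarrow> (nat \<Rightarrow> 'a) \<Rightarrow> nat list"
  where
  "far_indices \<Phi> \<Delta> K k z \<beta> =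
     filter (\<lambda>m. far_covering \<Phi> \<Delta> K (z m) (z (m - 1)) (\<beta> m)) [1..<k + 1]"

end

theory Submission
  imports Defs
begin

text \<open>
  Each single covering is described by its near or far edge, so the whole formula should follow by
  multiplying these descriptions along the chain. Write \<open>z = w t\<^sub>v\<^sub>\<mu>\<close>. A near covering with label
  \<open>\<alpha>\<close> replaces \<open>(wv, v, \<mu>)\<close> by \<open>(wvr\<^sub>\<alpha>, v, \<mu> + wt)\<close>, and a far covering replaces it by
  \<open>(wv, vr\<^sub>\<alpha>, \<mu> + wt)\<close>. Thus near coverings only extend the walk starting at \<open>wv\<close>, far coverings
  only prepend an edge to the walk ending at \<open>v\<close>, and every edge adds its weight to \<open>\<mu>\<close>.

  The one point that needs an argument is that consecutive descriptions fit together: the triple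
  produced by one covering has to be the triple from which the next covering is described. For this,
  the weight of one edge must not push a sufficiently regular \<open>\<mu>\<close> out of the antidominant
  chamber, which is where the constant \<open>K\<^sub>0\<close> comes from: it exceeds every \<open>\<bar>\<langle>\<alpha>\<^sup>\<or>, \<beta>\<rangle>\<bar>\<close>
  (lemma \<open>antidominant_add_edge_weight\<close>). Moreover the presentation of an element of the affine
  Weyl group by \<open>w\<close>, \<open>v\<close> and an antidominant \<open>\<mu>\<close> must be unique as soon as a second presentation has
  a regular \<open>\<mu>\<close> (lemma \<open>presentation_unique\<close>).

  Uniqueness is the classical fact that no nontrivial element of the finite Weyl group maps
  an antidominant vector into the open antidominant chamber. Such an element preserves positivity of
  roots; writing it as a word in simple reflections, the deletion argument
  (lemmas \<open>deletion\<close> and \<open>word_preserving_positivity\<close>) shortens the word until it is empty.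
\<close>

section \<open>Reflections and the finite Weyl group\<close>

abbreviation word :: "'a::euclidean_space list \<Rightarrow> 'a \<Rightarrow> 'a" where
  "word bs \<equiv> comp_list (map root_refl bs)"

lemma comp_list_Nil [simp]: "comp_list [] = id"
  and comp_list_Cons [simp]: "comp_list (g # gs) = g \<circ> comp_list gs"
  by (simp_all add: comp_list_def)

lemma comp_list_append [simp]: "comp_list (gs @ hs) = comp_list gs \<circ> comp_list hs"
  by (induction gs) (simp_all add: o_assoc)

lemma orthogonal_root_refl: "orthogonal_transformation (root_refl a)"
proof -
  have "linear (root_refl a)"
    by (rule linearI)
      (simp_all add: root_refl_def inner_add_left scaleR_add_left scaleR_diff_right)
  moreover have "root_refl a x \<bullet> root_refl a y = x \<bullet> y" for x y
    by (cases "a = 0")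
      (simp_all add: root_refl_def coroot_def inner_diff_left inner_diff_right inner_commute field_simps)
  ultimately show ?thesis
    by (simp add: orthogonal_transformation_def)
qed

lemma root_refl_root_refl [simp]: "root_refl a (root_refl a x) = x"
proof (cases "a = 0")
  case False
  then have "coroot a \<bullet> a = 2"
    by (simp add: coroot_def)
  then show ?thesis
    by (simp add: root_refl_def inner_diff_left)
qed (simp add: root_refl_def coroot_def)

lemma root_refl_comp_self [simp]: "root_refl a \<circ> root_refl a = id"
  by (simp add: fun_eq_iff)

lemma root_refl_self:
  assumes "a \<noteq> 0"
  shows "root_refl a a = - a"
proof -
  have "(a \<bullet> a) *\<^sub>R coroot a = 2 *\<^sub>R a"
    using assms by (simp add: coroot_def)
  then show ?thesis
    by (simp add: root_refl_def scaleR_2)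
qed

lemma root_refl_conjugate:
  assumes "orthogonal_transformation f"
  shows "root_refl (f a) \<circ> f = f \<circ> root_refl a"
  using assms
  by (auto simp: fun_eq_iff root_refl_def coroot_def orthogonal_transformation_def
      linear_diff linear_scale)

lemma finite_weyl_eq_words: "finite_weyl \<Phi> = {word bs | bs. set bs \<subseteq> \<Phi>}"
proof -
  have "set gs \<subseteq> root_refl ` \<Phi> \<longleftrightarrow> (\<exists>bs. gs = map root_refl bs \<and> set bs \<subseteq> \<Phi>)" for gs
    using lists_image[of root_refl \<Phi>] by (auto simp: lists_eq_set)
  then show ?thesis
    unfolding finite_weyl_def by (simp only:) blast
qed

lemma finite_weyl_comp:
  assumes "f \<in> finite_weyl \<Phi>" and "g \<in> finite_weyl \<Phi>"
  shows "f \<circ> g \<in> finite_weyl \<Phi>"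
proof -
  obtain as bs where "f = word as" "set as \<subseteq> \<Phi>" "g = word bs" "set bs \<subseteq> \<Phi>"
    using assms unfolding finite_weyl_eq_words by blast
  then have "f \<circ> g = word (as @ bs) \<and> set (as @ bs) \<subseteq> \<Phi>"
    by simp
  then show ?thesis
    unfolding finite_weyl_eq_words by blast
qed

lemma root_refl_in_finite_weyl: "a \<in> \<Phi> \<Longrightarrow> root_refl a \<in> finite_weyl \<Phi>"
  unfolding finite_weyl_eq_words by (auto intro!: exI[of _ "[a]"])

lemma orthogonal_word: "orthogonal_transformation (word bs)"
proof (induction bs)
  case Nil
  show ?case
    by (simp add: orthogonal_transformation_def linear_id)
next
  case (Cons b bs)
  then show ?case
    using orthogonal_transformation_compose[OF orthogonal_root_refl]
    by (simp only: list.map comp_list_Cons)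
qed

lemma finite_weyl_orthogonal: "f \<in> finite_weyl \<Phi> \<Longrightarrow> orthogonal_transformation f"
  unfolding finite_weyl_eq_words using orthogonal_word by blast

lemma finite_weyl_bij: "f \<in> finite_weyl \<Phi> \<Longrightarrow> bij f"
  by (intro orthogonal_transformation_bij finite_weyl_orthogonal)

lemma finite_weyl_comp_inv: "f \<in> finite_weyl \<Phi> \<Longrightarrow> f \<circ> inv f = id"
  by (rule iffD1[OF surj_iff bij_is_surj[OF finite_weyl_bij]])

lemma word_rev_comp [simp]: "word (rev bs) \<circ> word bs = id"
proof (induction bs)
  case (Cons b bs)
  have "word (rev (b # bs)) \<circ> word (b # bs)
      = word (rev bs) \<circ> (root_refl b \<circ> root_refl b) \<circ> word bs"
    by (simp only: rev.simps map_append list.map comp_list_append comp_list_Cons comp_list_Nil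
        comp_id o_assoc)
  with Cons show ?case
    by simp
qed simp

lemma finite_weyl_inv:
  assumes "f \<in> finite_weyl \<Phi>"
  shows "inv f \<in> finite_weyl \<Phi>"
proof -
  obtain bs where bs: "f = word bs" "set bs \<subseteq> \<Phi>"
    using assms unfolding finite_weyl_eq_words by blast
  have "inv f = word (rev bs) \<circ> f \<circ> inv f"
    by (simp add: bs(1))
  also have "\<dots> = word (rev bs)"
    using finite_weyl_comp_inv[OF assms] by (simp only: o_assoc[symmetric] comp_id)
  finally have "inv f = word (rev bs) \<and> set (rev bs) \<subseteq> \<Phi>"
    using bs by simp
  then show ?thesis
    unfolding finite_weyl_eq_words by blast
qed

lemma root_refl_in_roots:
  assumes "root_system \<Phi>" and "a \<in> \<Phi>" and "b \<in> \<Phi>"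
  shows "root_refl a b \<in> \<Phi>"
  using assms unfolding root_system_def by blast

lemma word_in_roots:
  assumes "root_system \<Phi>" and "set bs \<subseteq> \<Phi>" and "b \<in> \<Phi>"
  shows "word bs b \<in> \<Phi>"
  using assms(2) by (induction bs) (auto simp: assms(1,3) root_refl_in_roots)

lemma finite_weyl_in_roots:
  assumes "root_system \<Phi>" and "f \<in> finite_weyl \<Phi>" and "b \<in> \<Phi>"
  shows "f b \<in> \<Phi>"
  using assms word_in_roots unfolding finite_weyl_eq_words by blast

section \<open>The action on chambers\<close>

text \<open>
  A root is positive exactly when it has positive inner product with a fixed vector \<open>d\<close> of the open
  dominant chamber. Such a \<open>d\<close> is at hand wherever the results below are applied, and it replaces
  all counting of coefficients by one linear functional, which also serves as a height.
\<close>

locale dominant_vector =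
  fixes \<Phi> \<Delta> :: "'a::euclidean_space set" and d :: 'a
  assumes root_system: "root_system \<Phi>"
    and reduced: "reduced_roots \<Phi>"
    and simple: "simple_roots \<Phi> \<Delta>"
    and dominant: "\<And>a. a \<in> \<Delta> \<Longrightarrow> a \<bullet> d > 0"
begin

lemma simple_subset: "\<Delta> \<subseteq> \<Phi>"
  using simple by (simp add: simple_roots_def)

lemma root_nonzero: "b \<in> \<Phi> \<Longrightarrow> b \<noteq> 0"
  using root_system unfolding root_system_def by blast

lemma finite_roots: "finite \<Phi>"
  using root_system by (simp add: root_system_def)

lemma finite_simple: "finite \<Delta>"
  using finite_subset[OF simple_subset finite_roots] .

lemma nonneg_comb_inner_pos:
  assumes "nonneg_comb \<Delta> b" and "b \<noteq> 0"
  shows "b \<bullet> d > 0"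
proof -
  obtain c :: "'a \<Rightarrow> nat" where c: "b = (\<Sum>a\<in>\<Delta>. real (c a) *\<^sub>R a)"
    using assms(1) unfolding nonneg_comb_def by blast
  then obtain a where "a \<in> \<Delta>" "c a \<noteq> 0"
    using assms(2) by (metis (no_types, lifting) of_nat_0 scale_zero_left sum.neutral)
  then have "0 < (\<Sum>a\<in>\<Delta>. real (c a) * (a \<bullet> d))"
    using dominant finite_simple
    by (intro sum_pos2[of _ a]) (auto intro!: mult_nonneg_nonneg less_imp_le[OF dominant])
  then show ?thesis
    by (simp add: c inner_sum_left)
qed

lemma nonneg_comb_iff_inner_pos:
  assumes "b \<in> \<Phi>"
  shows "nonneg_comb \<Delta> b \<longleftrightarrow> b \<bullet> d > 0"
proof
  assume "b \<bullet> d > 0"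
  then have "\<not> nonneg_comb \<Delta> (- b)"
    using nonneg_comb_inner_pos[of "- b"] root_nonzero[OF assms] by auto
  then show "nonneg_comb \<Delta> b"
    using simple assms by (auto simp: simple_roots_def)
qed (use nonneg_comb_inner_pos root_nonzero[OF assms] in blast)

lemma root_inner_nonzero:
  assumes "b \<in> \<Phi>"
  shows "b \<bullet> d \<noteq> 0"
  using assms simple nonneg_comb_inner_pos[of b] nonneg_comb_inner_pos[of "- b"] root_nonzero[OF assms]
  by (auto simp: simple_roots_def)

text \<open>
  A positive root other than \<open>a\<close> is not a multiple of \<open>a\<close>, so it has a positive coefficient at
  another simple root. The reflection in \<open>a\<close> keeps that coefficient, and one positive coefficient
  decides the sign of a root.
\<close>

lemma simple_reflection_pos:
  assumes a: "a \<in> \<Delta>" and b: "b \<in> \<Phi>" "b \<bullet> d > 0" "b \<noteq> a"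
  shows "root_refl a b \<bullet> d > 0"
proof (rule ccontr)
  assume neg: "\<not> root_refl a b \<bullet> d > 0"
  have "root_refl a b \<in> \<Phi>"
    using root_refl_in_roots[OF root_system] a b(1) simple_subset by blast
  with neg have "nonneg_comb \<Delta> (- root_refl a b)"
    using simple nonneg_comb_iff_inner_pos by (auto simp: simple_roots_def)
  then obtain e :: "'a \<Rightarrow> nat" where e: "- root_refl a b = (\<Sum>x\<in>\<Delta>. real (e x) *\<^sub>R x)"
    unfolding nonneg_comb_def by blast
  obtain c :: "'a \<Rightarrow> nat" where c: "b = (\<Sum>x\<in>\<Delta>. real (c x) *\<^sub>R x)"
    using nonneg_comb_iff_inner_pos b unfolding nonneg_comb_def by blast
  have "\<exists>g\<in>\<Delta>. g \<noteq> a \<and> c g \<noteq> 0"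
  proof (rule ccontr)
    assume "\<not> ?thesis"
    then have "(\<Sum>x\<in>\<Delta> - {a}. real (c x) *\<^sub>R x) = 0"
      by (intro sum.neutral) auto
    then have "b = real (c a) *\<^sub>R a"
      using c sum.remove[OF finite_simple a, of "\<lambda>x. real (c x) *\<^sub>R x"] by simp
    moreover from this have "real (c a) = 1 \<or> real (c a) = - 1"
      using reduced a b(1) simple_subset unfolding reduced_roots_def by (metis subsetD)
    ultimately show False
      using b(3) by auto
  qed
  then obtain g where g: "g \<in> \<Delta>" "g \<noteq> a" "c g \<noteq> 0"
    by blast
  define t where "t = (b \<bullet> a) * (2 / (a \<bullet> a))"
  have t: "(\<Sum>x\<in>\<Delta>. (if x = a then t else 0) *\<^sub>R x) = t *\<^sub>R a"
    using finite_simple a by (simp add: if_distrib[of "\<lambda>r. r *\<^sub>R _"] cong: if_cong)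
  have "b - t *\<^sub>R a + - root_refl a b = 0"
    by (simp add: root_refl_def coroot_def t_def)
  then have "(\<Sum>x\<in>\<Delta>. (real (c x) - (if x = a then t else 0) + real (e x)) *\<^sub>R x) = 0"
    by (simp only: scaleR_add_left scaleR_diff_left sum.distrib sum_subtractf t c[symmetric] e[symmetric])
  then have "real (c g) - (if g = a then t else 0) + real (e g) = 0"
    using independentD[of \<Delta> \<Delta> "\<lambda>x. real (c x) - (if x = a then t else 0) + real (e x)" g] simple g(1) finite_simple
    by (auto simp: simple_roots_def)
  with g show False
    by simp
qed

text \<open>
  The positive root \<open>g\<close> of smallest height \<open>g \<bullet> d\<close> in the orbit of \<open>b\<close> under the simple
  reflections has positive inner product with some simple root, and reflecting in that simple root would lower the height unless
  \<open>g\<close> is itself simple.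
\<close>

lemma root_conjugate_to_simple:
  assumes b: "b \<in> \<Phi>" "b \<bullet> d > 0"
  shows "\<exists>bs. set bs \<subseteq> \<Delta> \<and> word bs b \<in> \<Delta>"
proof -
  define S where "S = {g. g \<bullet> d > 0 \<and> (\<exists>bs. set bs \<subseteq> \<Delta> \<and> g = word bs b)}"
  have S_roots: "S \<subseteq> \<Phi>"
    using word_in_roots[OF root_system _ b(1)] simple_subset unfolding S_def by blast
  have "b \<in> S"
    unfolding S_def using b by (auto intro!: exI[of _ "[]"])
  then have "S \<noteq> {}" and "finite S"
    using finite_subset[OF S_roots finite_roots] by auto
  then obtain g where g: "g \<in> S" and min: "\<And>h. h \<in> S \<Longrightarrow> g \<bullet> d \<le> h \<bullet> d"
    using arg_min_if_finite[of S "\<lambda>g. g \<bullet> d"] by (metis not_le)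
  obtain bs where bs: "set bs \<subseteq> \<Delta>" "g = word bs b"
    using g unfolding S_def by blast
  have gpos: "g \<bullet> d > 0"
    using g by (simp add: S_def)
  obtain c :: "'a \<Rightarrow> nat" where c: "g = (\<Sum>x\<in>\<Delta>. real (c x) *\<^sub>R x)"
    using nonneg_comb_iff_inner_pos gpos g S_roots unfolding nonneg_comb_def by blast
  have "0 < g \<bullet> g"
    using g S_roots root_nonzero by auto
  also have "g \<bullet> g = (\<Sum>x\<in>\<Delta>. real (c x) * (x \<bullet> g))"
    by (subst (1) c) (simp add: inner_sum_left)
  finally obtain a where a: "a \<in> \<Delta>" "real (c a) * (a \<bullet> g) > 0"
    by (metis (no_types, lifting) not_le sum_nonpos)
  then have ag: "a \<bullet> g > 0"
    by (simp add: zero_less_mult_iff)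
  have "g = a"
  proof (rule ccontr)
    assume "g \<noteq> a"
    then have "root_refl a g \<bullet> d > 0"
      using simple_reflection_pos a(1) gpos g S_roots by blast
    moreover have "root_refl a g = word (a # bs) b" "set (a # bs) \<subseteq> \<Delta>"
      using bs a(1) by simp_all
    ultimately have "root_refl a g \<in> S"
      unfolding S_def by blast
    then have "g \<bullet> d \<le> root_refl a g \<bullet> d"
      by (rule min)
    moreover have "(g \<bullet> a) * (2 / (a \<bullet> a)) * (a \<bullet> d) > 0"
      using ag dominant[OF a(1)] root_nonzero a(1) simple_subset
      by (intro mult_pos_pos divide_pos_pos) (auto simp: inner_commute)
    ultimately show False
      by (simp add: root_refl_def coroot_def inner_diff_left)
  qed
  then show ?thesis
    using bs a(1) by blast
qed

lemma root_refl_eq_simple_word: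
  assumes "b \<in> \<Phi>"
  shows "\<exists>cs. set cs \<subseteq> \<Delta> \<and> root_refl b = word cs"
proof -
  have pos: "\<exists>cs. set cs \<subseteq> \<Delta> \<and> root_refl b = word cs" if b: "b \<in> \<Phi>" "b \<bullet> d > 0" for b
  proof -
    obtain bs where bs: "set bs \<subseteq> \<Delta>" "word bs b \<in> \<Delta>"
      using root_conjugate_to_simple[OF b] by blast
    have "root_refl b = word (rev bs) \<circ> (word bs \<circ> root_refl b)"
      by (simp add: o_assoc)
    also have "\<dots> = word (rev bs) \<circ> (root_refl (word bs b) \<circ> word bs)"
      by (simp add: root_refl_conjugate[OF orthogonal_word])
    also have "\<dots> = word (rev bs @ [word bs b] @ bs)"
      by simp
    finally show ?thesis
      using bs by (intro exI[of _ "rev bs @ [word bs b] @ bs"]) simp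
  qed
  show ?thesis
  proof (cases "b \<bullet> d > 0")
    case False
    have "root_refl b b \<in> \<Phi>"
      by (rule root_refl_in_roots[OF root_system assms assms])
    then have "- b \<in> \<Phi>"
      by (simp add: root_refl_self root_nonzero[OF assms])
    moreover have "- b \<bullet> d > 0"
      using False root_inner_nonzero[OF assms] by simp
    moreover have "root_refl (- b) = root_refl b"
      by (simp add: fun_eq_iff root_refl_def coroot_def)
    ultimately show ?thesis
      using pos[of "- b"] by simp
  qed (use pos assms in blast)
qed

lemma finite_weyl_eq_simple_word:
  assumes "f \<in> finite_weyl \<Phi>"
  shows "\<exists>cs. set cs \<subseteq> \<Delta> \<and> f = word cs"
proof -
  obtain bs where bs: "f = word bs" "set bs \<subseteq> \<Phi>"
    using assms unfolding finite_weyl_eq_words by blast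
  have "\<exists>cs. set cs \<subseteq> \<Delta> \<and> word bs = word cs"
    using bs(2)
  proof (induction bs)
    case Nil
    show ?case
      by (intro exI[of _ "[]"]) simp
  next
    case (Cons b bs)
    then obtain cs es where "set cs \<subseteq> \<Delta>" "word bs = word cs" "set es \<subseteq> \<Delta>" "root_refl b = word es"
      using root_refl_eq_simple_word[of b] by auto
    then show ?case
      by (intro exI[of _ "es @ cs"]) simp
  qed
  with bs(1) show ?thesis
    by simp
qed

text \<open>
  Reading the word from the right, there is a letter \<open>b\<close> at which the image of \<open>a\<close> turns
  negative. By \<open>simple_reflection_pos\<close> this image is \<open>b\<close> itself, so the letter \<open>b\<close> can be moved
  through the letters to its right, where it becomes \<open>a\<close> and cancels.
\<close>

lemma deletion:
  assumes "a \<in> \<Delta>" and "set bs \<subseteq> \<Delta>" and "word bs a \<bullet> d < 0"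
  shows "\<exists>cs. set cs \<subseteq> \<Delta> \<and> length cs < length bs \<and> word bs \<circ> root_refl a = word cs"
  using assms(2,3)
proof (induction bs)
  case Nil
  then show ?case
    using dominant[OF assms(1)] by simp
next
  case (Cons b bs)
  have root: "word bs a \<in> \<Phi>"
    using word_in_roots[OF root_system] Cons.prems(1) assms(1) simple_subset by auto
  show ?case
  proof (cases "word bs a \<bullet> d < 0")
    case True
    have "set bs \<subseteq> \<Delta>"
      using Cons.prems(1) by simp
    then obtain cs where cs: "set cs \<subseteq> \<Delta>" "length cs < length bs" "word bs \<circ> root_refl a = word cs"
      using Cons.IH True by blast
    have "word (b # bs) \<circ> root_refl a = word (b # cs)"
      by (simp only: list.map comp_list_Cons o_assoc[symmetric] cs(3))
    moreover have "set (b # cs) \<subseteq> \<Delta>" "length (b # cs) < length (b # bs)"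
      using Cons.prems(1) cs(1,2) by simp_all
    ultimately show ?thesis
      by blast
  next
    case False
    then have pos: "word bs a \<bullet> d > 0"
      using root_inner_nonzero[OF root] by linarith
    have "\<not> root_refl b (word bs a) \<bullet> d > 0"
      using Cons.prems(2) by simp
    then have "word bs a = b"
      using simple_reflection_pos[OF _ root pos] Cons.prems(1) by auto
    then have "word bs \<circ> root_refl a = root_refl b \<circ> word bs"
      using root_refl_conjugate[OF orthogonal_word[of bs], of a] by simp
    then have "word (b # bs) \<circ> root_refl a = root_refl b \<circ> (root_refl b \<circ> word bs)"
      by (simp only: list.map comp_list_Cons o_assoc[symmetric])
    also have "\<dots> = word bs"
      by (simp only: o_assoc root_refl_comp_self id_comp)
    finally have "word (b # bs) \<circ> root_refl a = word bs" .
    moreover have "set bs \<subseteq> \<Delta>" "length bs < length (b # bs)"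
      using Cons.prems(1) by simp_all
    ultimately show ?thesis
      by blast
  qed
qed

text \<open>
  If the last letter of the word is \<open>a\<close>, then the word without it sends \<open>a\<close> to a negative
  root, so \<open>deletion\<close> yields a word for the same element that is shorter by at least two letters.
\<close>

lemma word_preserving_positivity:
  assumes "set bs \<subseteq> \<Delta>" and "\<And>a. a \<in> \<Delta> \<Longrightarrow> word bs a \<bullet> d > 0"
  shows "word bs = id"
  using assms
proof (induction "length bs" arbitrary: bs rule: less_induct)
  case (less bs)
  show ?case
  proof (cases bs rule: rev_cases)
    case (snoc as a)
    have a: "a \<in> \<Delta>"
      using less.prems(1) snoc by simp
    have "word bs a = word as (root_refl a a)"
      by (simp add: snoc)
    also have "\<dots> = - word as a"
      using a simple_subset root_nonzero orthogonal_word[of as]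
      by (auto simp: root_refl_self orthogonal_transformation_def linear_neg)
    finally have "word as a \<bullet> d < 0"
      using less.prems(2)[OF a] by simp
    moreover have "set as \<subseteq> \<Delta>"
      using less.prems(1) snoc by simp
    ultimately obtain cs where cs: "set cs \<subseteq> \<Delta>" "length cs < length as" "word as \<circ> root_refl a = word cs"
      using deletion[OF a] by blast
    have "word bs = word cs"
      using cs(3) by (simp add: snoc)
    moreover have "word cs = id"
    proof (rule less.hyps)
      show "length cs < length bs"
        using cs(2) by (simp add: snoc)
      show "word cs a \<bullet> d > 0" if "a \<in> \<Delta>" for a
        using less.prems(2)[OF that] \<open>word bs = word cs\<close> by simp
    qed (fact cs(1))
    ultimately show ?thesis
      by simp
  qed simp
qed

text \<open>
  The image \<open>d\<close> of \<open>e\<close> lies on no root hyperplane, so neither does \<open>e\<close>. Hence \<open>e\<close> lies in the open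
  chamber as well, both vectors define the same positive roots, and \<open>u\<close> preserves them.
\<close>

lemma chamber_stabilizer_trivial:
  assumes u: "u \<in> finite_weyl \<Phi>" and e: "\<And>a. a \<in> \<Delta> \<Longrightarrow> a \<bullet> e \<ge> 0" and ue: "u e = d"
  shows "u = id"
proof -
  obtain bs where bs: "set bs \<subseteq> \<Delta>" "u = word bs"
    using finite_weyl_eq_simple_word[OF u] by blast
  have "u a \<bullet> d > 0" if "a \<in> \<Delta>" for a
  proof -
    have "u a \<bullet> d = a \<bullet> e"
      using finite_weyl_orthogonal[OF u] ue by (auto simp: orthogonal_transformation_def)
    moreover have "u a \<bullet> d \<noteq> 0"
      using that simple_subset root_inner_nonzero finite_weyl_in_roots[OF root_system u] by blast
    ultimately show ?thesis
      using e[OF that] by simp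
  qed
  then show ?thesis
    using word_preserving_positivity bs by blast
qed

end

section \<open>Uniqueness of presentations\<close>

lemma comp_transl_cancel:
  assumes "orthogonal_transformation f" and "orthogonal_transformation g"
    and eq: "f \<circ> transl a = g \<circ> transl b"
  shows "f = g \<and> a = b"
proof -
  have lin: "linear f" "linear g"
    using assms by (auto simp: orthogonal_transformation_def)
  have shifted: "f x + f a = g x + g b" for x
    using fun_cong[OF eq, of x] by (simp add: transl_def linear_add lin)
  from shifted[of 0] have const: "f a = g b"
    by (simp add: linear_0 lin)
  with shifted have "f = g"
    by (simp add: fun_eq_iff)
  with const show ?thesis
    using orthogonal_transformation_inj[OF assms(1)] by (simp add: inj_eq)
qed

text \<open>
  Comparing linear and translation parts leaves \<open>v \<mu> = v' \<mu>'\<close>, that is, \<open>v'\<^sup>-\<^sup>1 v\<close> maps \<open>\<mu>\<close> to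
  \<open>\<mu>'\<close>. After a change of sign this is a dominant vector mapped to a strictly dominant one.
\<close>

lemma presentation_unique:
  assumes \<Phi>: "root_system \<Phi>" "reduced_roots \<Phi>" "simple_roots \<Phi> \<Delta>"
    and "w \<in> finite_weyl \<Phi>" and v: "v \<in> finite_weyl \<Phi>" and anti: "antidominant \<Delta> \<mu>"
    and pres: "regular_presentation \<Phi> \<Delta> K (w \<circ> transl (v \<mu>)) w' v' \<mu>'" and "K > 0"
  shows "w' = w \<and> v' = v \<and> \<mu>' = \<mu>"
proof -
  have w': "w' \<in> finite_weyl \<Phi>" and v': "v' \<in> finite_weyl \<Phi>"
    and anti': "antidominant \<Delta> \<mu>'" and reg': "suff_regular \<Delta> K \<mu>'"
    and eq: "w \<circ> transl (v \<mu>) = w' \<circ> transl (v' \<mu>')"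
    using pres by (auto simp: regular_presentation_def)
  have ww': "w = w'" and vv': "v \<mu> = v' \<mu>'"
    using comp_transl_cancel[OF _ _ eq] assms(4) w' finite_weyl_orthogonal by blast+
  interpret dominant_vector \<Phi> \<Delta> "- \<mu>'"
  proof
    show "a \<bullet> - \<mu>' > 0" if "a \<in> \<Delta>" for a
      using that anti' reg' \<open>K > 0\<close>
      by (force simp: antidominant_def suff_regular_def inner_commute)
  qed (fact \<Phi>)+
  have inj': "inj v'" and surj': "surj v'"
    using finite_weyl_bij[OF v'] by (simp_all add: bij_def)
  define u where "u = inv v' \<circ> v"
  have u: "u \<in> finite_weyl \<Phi>"
    unfolding u_def using finite_weyl_comp finite_weyl_inv v v' by blast
  have u\<mu>: "u \<mu> = \<mu>'"
    by (simp add: u_def vv' inj')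
  then have "u (- \<mu>) = - \<mu>'"
    using finite_weyl_orthogonal[OF u] by (simp add: orthogonal_transformation_def linear_neg)
  then have "u = id"
    using chamber_stabilizer_trivial[OF u, of "- \<mu>"] anti by (simp add: antidominant_def inner_commute)
  moreover have "v = v' \<circ> u"
    using surj' by (simp add: u_def o_assoc surj_iff)
  ultimately show ?thesis
    using ww' u\<mu> by simp
qed

definition pairing_bound :: "'a::euclidean_space set \<Rightarrow> real" where
  "pairing_bound \<Phi> = (\<Sum>\<alpha>\<in>\<Phi>. \<Sum>\<beta>\<in>\<Phi>. \<bar>coroot \<alpha> \<bullet> \<beta>\<bar>)"

lemma pairing_le_bound:
  assumes "finite \<Phi>" and "\<alpha> \<in> \<Phi>" and "\<beta> \<in> \<Phi>"
  shows "coroot \<alpha> \<bullet> \<beta> \<le> pairing_bound \<Phi>"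
proof -
  have "coroot \<alpha> \<bullet> \<beta> \<le> \<bar>coroot \<alpha> \<bullet> \<beta>\<bar>"
    by simp
  also have "\<dots> \<le> (\<Sum>\<beta>\<in>\<Phi>. \<bar>coroot \<alpha> \<bullet> \<beta>\<bar>)"
    by (rule member_le_sum) (use assms in auto)
  also have "\<dots> \<le> pairing_bound \<Phi>"
    unfolding pairing_bound_def
    by (rule member_le_sum[of \<alpha> \<Phi> "\<lambda>\<alpha>. \<Sum>\<beta>\<in>\<Phi>. \<bar>coroot \<alpha> \<bullet> \<beta>\<bar>"]) (use assms in \<open>auto intro: sum_nonneg\<close>)
  finally show ?thesis .
qed

lemma pairing_bound_nonneg: "pairing_bound \<Phi> \<ge> 0"
  unfolding pairing_bound_def by (intro sum_nonneg) auto

lemma antidominant_add_edge_weight: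
  assumes "finite \<Phi>" and "\<Delta> \<subseteq> \<Phi>" and "snd e \<in> \<Phi>"
    and "antidominant \<Delta> \<mu>" and "suff_regular \<Delta> K \<mu>" and "K \<ge> pairing_bound \<Phi>"
  shows "antidominant \<Delta> (\<mu> + edge_weight \<Phi> \<Delta> e)"
  unfolding antidominant_def
proof
  fix a assume a: "a \<in> \<Delta>"
  have "edge_weight \<Phi> \<Delta> e \<bullet> a \<le> pairing_bound \<Phi>"
    using pairing_le_bound[of \<Phi> "snd e" a] pairing_bound_nonneg[of \<Phi>] assms a
    by (auto simp: edge_weight_def)
  moreover have "\<mu> \<bullet> a \<le> - K"
    using assms(4,5) a by (force simp: antidominant_def suff_regular_def)
  ultimately show "(\<mu> + edge_weight \<Phi> \<Delta> e) \<bullet> a \<le> 0"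
    using assms(6) by (simp add: inner_add_left)
qed

section \<open>Walks along a saturated chain\<close>

lemma wf_digraph_qbg: "wf_digraph (qbg \<Phi> \<Delta>)"
proof
  fix e assume "e \<in> arcs (qbg \<Phi> \<Delta>)"
  then obtain w \<alpha> where e: "e = (w, \<alpha>)" "w \<in> finite_weyl \<Phi>" "\<alpha> \<in> \<Phi>"
    by (auto simp: qbg_def pos_roots_def)
  then show "tail (qbg \<Phi> \<Delta>) e \<in> verts (qbg \<Phi> \<Delta>)" "head (qbg \<Phi> \<Delta>) e \<in> verts (qbg \<Phi> \<Delta>)"
    by (simp_all add: qbg_def finite_weyl_comp root_refl_in_finite_weyl)
qed

lemma awalk_qbg_edge:
  assumes "(w, \<alpha>) \<in> arcs (qbg \<Phi> \<Delta>)"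
  shows "pre_digraph.awalk (qbg \<Phi> \<Delta>) w [(w, \<alpha>)] (w \<circ> root_refl \<alpha>)"
  using wf_digraph.arc_implies_awalk[OF wf_digraph_qbg assms] by (simp add: qbg_def)

lemma qbg_arc_label: "e \<in> arcs (qbg \<Phi> \<Delta>) \<Longrightarrow> snd e \<in> \<Phi>"
  by (auto simp: qbg_def pos_roots_def)

lemma path_weight_append [simp]:
  "path_weight \<Phi> \<Delta> (p @ q) = path_weight \<Phi> \<Delta> p + path_weight \<Phi> \<Delta> q"
  by (simp add: path_weight_def)

lemma path_weight_single [simp]: "path_weight \<Phi> \<Delta> [e] = edge_weight \<Phi> \<Delta> e"
  by (simp add: path_weight_def)

lemma path_weight_Nil [simp]: "path_weight \<Phi> \<Delta> [] = 0"
  by (simp add: path_weight_def)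

lemma near_indices_Suc:
  "near_indices \<Phi> \<Delta> K (Suc m) z \<beta> = near_indices \<Phi> \<Delta> K m z \<beta> @
     (if near_covering \<Phi> \<Delta> K (z (Suc m)) (z m) (\<beta> (Suc m)) then [Suc m] else [])"
  by (simp add: near_indices_def)

lemma far_indices_Suc:
  "far_indices \<Phi> \<Delta> K (Suc m) z \<beta> = far_indices \<Phi> \<Delta> K m z \<beta> @
     (if far_covering \<Phi> \<Delta> K (z (Suc m)) (z m) (\<beta> (Suc m)) then [Suc m] else [])"
  by (simp add: far_indices_def)

text \<open>
  The induction runs down the chain, and \<open>w\<^sub>m\<close>, \<open>v\<^sub>m\<close> present \<open>z m\<close>. Keeping them as existential
  witnesses, tied to the walks only through \<open>v\<^sub>m\<close> and the product \<open>w\<^sub>m v\<^sub>m\<close>, makes each of the two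
  kinds of covering change only one of these two quantities. The accumulated weight is merely
  antidominant, because the bottom element of the chain need not be sufficiently regular.
\<close>

lemma chain_walks:
  fixes \<Phi> \<Delta> :: "'a::euclidean_space set"
  assumes \<Phi>: "root_system \<Phi>" "reduced_roots \<Phi>" "simple_roots \<Phi> \<Delta>"
    and K: "K > pairing_bound \<Phi>"
    and wv: "w \<in> finite_weyl \<Phi>" "v \<in> finite_weyl \<Phi>" and anti: "antidominant \<Delta> \<mu>"
    and top: "z 0 = w \<circ> transl (v \<mu>)"
    and labels: "\<forall>i\<in>{1..m}. covering_label \<Phi> \<Delta> K (z i) (z (i - 1)) (\<beta> i)"
  shows "\<exists>w\<^sub>m v\<^sub>m P\<^sub>f P\<^sub>n. w\<^sub>m \<in> finite_weyl \<Phi> \<and> v\<^sub>m \<in> finite_weyl \<Phi> \<and>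
    v\<^sub>m = v \<circ> word (map \<beta> (far_indices \<Phi> \<Delta> K m z \<beta>)) \<and>
    w\<^sub>m \<circ> v\<^sub>m = w \<circ> v \<circ> word (map \<beta> (near_indices \<Phi> \<Delta> K m z \<beta>)) \<and>
    antidominant \<Delta> (\<mu> + path_weight \<Phi> \<Delta> P\<^sub>n + path_weight \<Phi> \<Delta> P\<^sub>f) \<and>
    z m = w\<^sub>m \<circ> transl (v\<^sub>m (\<mu> + path_weight \<Phi> \<Delta> P\<^sub>n + path_weight \<Phi> \<Delta> P\<^sub>f)) \<and>
    list_all2 (\<lambda>i e. near_edge \<Phi> \<Delta> K (z i) (z (i - 1)) (\<beta> i) e) (near_indices \<Phi> \<Delta> K m z \<beta>) P\<^sub>n \<and>
    list_all2 (\<lambda>i e. far_edge \<Phi> \<Delta> K (z i) (z (i - 1)) (\<beta> i) e) (rev (far_indices \<Phi> \<Delta> K m z \<beta>)) P\<^sub>f \<and>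
    pre_digraph.awalk (qbg \<Phi> \<Delta>) (w \<circ> v) P\<^sub>n (w\<^sub>m \<circ> v\<^sub>m) \<and>
    pre_digraph.awalk (qbg \<Phi> \<Delta>) v\<^sub>m P\<^sub>f v"
  using labels
proof (induction m)
  case 0
  have "w \<circ> v \<in> finite_weyl \<Phi>"
    using wv by (rule finite_weyl_comp)
  then have "w \<circ> v \<in> verts (qbg \<Phi> \<Delta>)" "v \<in> verts (qbg \<Phi> \<Delta>)"
    using wv by (simp_all add: qbg_def)
  then have "pre_digraph.awalk (qbg \<Phi> \<Delta>) (w \<circ> v) [] (w \<circ> v)"
    "pre_digraph.awalk (qbg \<Phi> \<Delta>) v [] v"
    by (simp_all only: wf_digraph.awalk_Nil_iff[OF wf_digraph_qbg])
  moreover have indices: "near_indices \<Phi> \<Delta> K 0 z \<beta> = []" "far_indices \<Phi> \<Delta> K 0 z \<beta> = []"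
    by (simp_all add: near_indices_def far_indices_def)
  ultimately show ?case
    using wv anti top
    by - (rule exI[of _ w], rule exI[of _ v], rule exI[of _ "[]"], rule exI[of _ "[]"],
      simp only: indices list.map rev.simps list_all2_Nil comp_list_Nil comp_id path_weight_Nil
        add_0_right simp_thms)
next
  case (Suc m)
  interpret G: wf_digraph "qbg \<Phi> \<Delta>"
    by (rule wf_digraph_qbg)
  have fin: "finite \<Phi>" "\<Delta> \<subseteq> \<Phi>"
    using \<Phi> by (auto simp: root_system_def simple_roots_def)
  have K0: "K > 0"
    using K pairing_bound_nonneg[of \<Phi>] by linarith
  let ?N = "near_indices \<Phi> \<Delta> K m z \<beta>" and ?F = "far_indices \<Phi> \<Delta> K m z \<beta>"
  let ?\<alpha> = "\<beta> (Suc m)"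
  have "\<forall>i\<in>{1..m}. covering_label \<Phi> \<Delta> K (z i) (z (i - 1)) (\<beta> i)"
    using Suc.prems by simp
  from Suc.IH[OF this]
  obtain w\<^sub>m v\<^sub>m P\<^sub>f P\<^sub>n where IH: "w\<^sub>m \<in> finite_weyl \<Phi>" "v\<^sub>m \<in> finite_weyl \<Phi>"
    "v\<^sub>m = v \<circ> word (map \<beta> ?F)" "w\<^sub>m \<circ> v\<^sub>m = w \<circ> v \<circ> word (map \<beta> ?N)"
    "antidominant \<Delta> (\<mu> + path_weight \<Phi> \<Delta> P\<^sub>n + path_weight \<Phi> \<Delta> P\<^sub>f)"
    "z m = w\<^sub>m \<circ> transl (v\<^sub>m (\<mu> + path_weight \<Phi> \<Delta> P\<^sub>n + path_weight \<Phi> \<Delta> P\<^sub>f))"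
    "list_all2 (\<lambda>i e. near_edge \<Phi> \<Delta> K (z i) (z (i - 1)) (\<beta> i) e) ?N P\<^sub>n"
    "list_all2 (\<lambda>i e. far_edge \<Phi> \<Delta> K (z i) (z (i - 1)) (\<beta> i) e) (rev ?F) P\<^sub>f"
    "G.awalk (w \<circ> v) P\<^sub>n (w\<^sub>m \<circ> v\<^sub>m)" "G.awalk v\<^sub>m P\<^sub>f v"
    by blast
  define \<nu> where "\<nu> = \<mu> + path_weight \<Phi> \<Delta> P\<^sub>n + path_weight \<Phi> \<Delta> P\<^sub>f"
  have unique: "w' = w\<^sub>m \<and> v' = v\<^sub>m \<and> \<mu>' = \<nu>"
    if "regular_presentation \<Phi> \<Delta> K (z m) w' v' \<mu>'" for w' v' \<mu>'
    unfolding \<nu>_def by (rule presentation_unique[OF \<Phi> IH(1,2,5) that[unfolded IH(6)] K0])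
  have label: "covering_label \<Phi> \<Delta> K (z (Suc m)) (z m) ?\<alpha>"
    using Suc.prems by force
  then have \<alpha>: "?\<alpha> \<in> \<Phi>"
    by (simp add: covering_label_def pos_roots_def)
  define w\<^sub>n where "w\<^sub>n = w\<^sub>m \<circ> root_refl (v\<^sub>m ?\<alpha>)"
  have "v\<^sub>m ?\<alpha> \<in> \<Phi>"
    by (rule finite_weyl_in_roots[OF \<Phi>(1) IH(2) \<alpha>])
  then have w\<^sub>n: "w\<^sub>n \<in> finite_weyl \<Phi>"
    unfolding w\<^sub>n_def using IH(1) finite_weyl_comp root_refl_in_finite_weyl by blast
  have w\<^sub>n_v\<^sub>m: "w\<^sub>n \<circ> v\<^sub>m = w\<^sub>m \<circ> v\<^sub>m \<circ> root_refl ?\<alpha>"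
    unfolding w\<^sub>n_def
    by (simp only: root_refl_conjugate[OF finite_weyl_orthogonal[OF IH(2)]] o_assoc[symmetric])
  have anti_add: "antidominant \<Delta> (\<nu> + edge_weight \<Phi> \<Delta> e)"
    if "regular_presentation \<Phi> \<Delta> K (z m) w\<^sub>m v\<^sub>m \<nu>" "e \<in> arcs (qbg \<Phi> \<Delta>)" for e
    using antidominant_add_edge_weight[OF fin qbg_arc_label[OF that(2)]] that(1) K
    by (auto simp: regular_presentation_def)
  from label consider
      (near) "near_covering \<Phi> \<Delta> K (z (Suc m)) (z m) ?\<alpha>" "\<not> far_covering \<Phi> \<Delta> K (z (Suc m)) (z m) ?\<alpha>"
    | (far) "far_covering \<Phi> \<Delta> K (z (Suc m)) (z m) ?\<alpha>" "\<not> near_covering \<Phi> \<Delta> K (z (Suc m)) (z m) ?\<alpha>"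
    unfolding covering_label_def by blast
  then show ?case
  proof cases
    case near
    then obtain e where e: "near_edge \<Phi> \<Delta> K (z (Suc m)) (z m) ?\<alpha> e"
      unfolding near_covering_def by blast
    then have edge: "regular_presentation \<Phi> \<Delta> K (z m) w\<^sub>m v\<^sub>m \<nu>" "e = (w\<^sub>m \<circ> v\<^sub>m, ?\<alpha>)"
      "e \<in> arcs (qbg \<Phi> \<Delta>)" "z (Suc m) = w\<^sub>n \<circ> transl (v\<^sub>m (\<nu> + edge_weight \<Phi> \<Delta> e))"
      unfolding near_edge_def w\<^sub>n_def using unique by blast+
    have weight: "\<mu> + path_weight \<Phi> \<Delta> (P\<^sub>n @ [e]) + path_weight \<Phi> \<Delta> P\<^sub>f = \<nu> + edge_weight \<Phi> \<Delta> e"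
      by (simp add: \<nu>_def)
    have "G.awalk (w\<^sub>m \<circ> v\<^sub>m) [e] (w\<^sub>n \<circ> v\<^sub>m)"
      using awalk_qbg_edge edge(2,3) w\<^sub>n_v\<^sub>m by metis
    with IH(9) have walk: "G.awalk (w \<circ> v) (P\<^sub>n @ [e]) (w\<^sub>n \<circ> v\<^sub>m)"
      by (rule G.awalk_appendI)
    have prod: "w\<^sub>n \<circ> v\<^sub>m = w \<circ> v \<circ> word (map \<beta> (?N @ [Suc m]))"
      by (simp only: w\<^sub>n_v\<^sub>m IH(4) map_append list.map comp_list_append comp_list_Cons comp_list_Nil
          comp_id o_assoc)
    have edges: "list_all2 (\<lambda>i e. near_edge \<Phi> \<Delta> K (z i) (z (i - 1)) (\<beta> i) e) (?N @ [Suc m]) (P\<^sub>n @ [e])"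
      using IH(7) e by (simp add: list_all2_appendI)
    have indices: "near_indices \<Phi> \<Delta> K (Suc m) z \<beta> = ?N @ [Suc m]" "far_indices \<Phi> \<Delta> K (Suc m) z \<beta> = ?F"
      using near by (simp_all add: near_indices_Suc far_indices_Suc)
    show ?thesis
      unfolding indices
      by (rule exI[of _ w\<^sub>n], rule exI[of _ v\<^sub>m], rule exI[of _ P\<^sub>f], rule exI[of _ "P\<^sub>n @ [e]"],
        unfold weight, intro conjI)
        (fact w\<^sub>n IH prod anti_add[OF edge(1,3)] edge edges walk)+
  next
    case far
    then obtain e where e: "far_edge \<Phi> \<Delta> K (z (Suc m)) (z m) ?\<alpha> e"
      unfolding far_covering_def by blast
    define v\<^sub>n where "v\<^sub>n = v\<^sub>m \<circ> root_refl ?\<alpha>"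
    from e have edge: "regular_presentation \<Phi> \<Delta> K (z m) w\<^sub>m v\<^sub>m \<nu>" "e = (v\<^sub>n, ?\<alpha>)"
      "e \<in> arcs (qbg \<Phi> \<Delta>)" "z (Suc m) = w\<^sub>n \<circ> transl (v\<^sub>n (\<nu> + edge_weight \<Phi> \<Delta> e))"
      unfolding far_edge_def w\<^sub>n_def v\<^sub>n_def using unique by blast+
    have weight: "\<mu> + path_weight \<Phi> \<Delta> P\<^sub>n + path_weight \<Phi> \<Delta> ([e] @ P\<^sub>f) = \<nu> + edge_weight \<Phi> \<Delta> e"
      unfolding path_weight_append path_weight_single by (simp add: \<nu>_def)
    have v\<^sub>n: "v\<^sub>n \<in> finite_weyl \<Phi>"
      unfolding v\<^sub>n_def using IH(2) \<alpha> finite_weyl_comp root_refl_in_finite_weyl by blast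
    have v\<^sub>n_eq: "v\<^sub>n = v \<circ> word (map \<beta> (?F @ [Suc m]))"
      by (simp only: v\<^sub>n_def IH(3) map_append list.map comp_list_append comp_list_Cons comp_list_Nil
          comp_id o_assoc)
    have head_e: "v\<^sub>n \<circ> root_refl ?\<alpha> = v\<^sub>m"
      by (simp only: v\<^sub>n_def o_assoc[symmetric] root_refl_comp_self comp_id)
    have same: "w\<^sub>n \<circ> v\<^sub>n = w\<^sub>m \<circ> v\<^sub>m"
      by (simp only: v\<^sub>n_def o_assoc w\<^sub>n_v\<^sub>m) (simp only: o_assoc[symmetric] root_refl_comp_self comp_id)
    have prod: "w\<^sub>n \<circ> v\<^sub>n = w \<circ> v \<circ> word (map \<beta> ?N)"
      unfolding same by (fact IH)
    have walk_n: "G.awalk (w \<circ> v) P\<^sub>n (w\<^sub>n \<circ> v\<^sub>n)"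
      unfolding same by (fact IH)
    have "G.awalk v\<^sub>n [e] v\<^sub>m"
      using awalk_qbg_edge edge(2,3) head_e by metis
    then have walk_f: "G.awalk v\<^sub>n ([e] @ P\<^sub>f) v"
      using IH(10) by (rule G.awalk_appendI)
    have edges: "list_all2 (\<lambda>i e. far_edge \<Phi> \<Delta> K (z i) (z (i - 1)) (\<beta> i) e)
        (rev (?F @ [Suc m])) ([e] @ P\<^sub>f)"
      using IH(8) e by simp
    have indices: "near_indices \<Phi> \<Delta> K (Suc m) z \<beta> = ?N" "far_indices \<Phi> \<Delta> K (Suc m) z \<beta> = ?F @ [Suc m]"
      using far by (simp_all add: near_indices_Suc far_indices_Suc)
    show ?thesis
      unfolding indices
      by (rule exI[of _ w\<^sub>n], rule exI[of _ v\<^sub>n], rule exI[of _ "[e] @ P\<^sub>f"], rule exI[of _ P\<^sub>n],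
        unfold weight, intro conjI)
        (fact w\<^sub>n v\<^sub>n v\<^sub>n_eq IH prod anti_add[OF edge(1,3)] edge edges walk_n walk_f)+
  qed
qed

theorem lemma10:
  fixes \<Phi> :: "'a::euclidean_space set"
  assumes "root_system \<Phi>" and "crystallographic \<Phi>" and "reduced_roots \<Phi>" and "irreducible_roots \<Phi>"
  shows "\<exists>K\<^sub>0 :: real. \<forall>K \<ge> K\<^sub>0. \<forall>\<Delta> x y w v \<mu> k z \<beta>.
    simple_roots \<Phi> \<Delta> \<and>
    w \<in> finite_weyl \<Phi> \<and> v \<in> finite_weyl \<Phi> \<and> \<mu> \<in> coroot_lattice \<Phi> \<and> antidominant \<Delta> \<mu> \<and>
    y = w \<circ> transl (v \<mu>) \<and>
    bruhat_less \<Phi> \<Delta> x y \<and>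
    saturated_chain \<Phi> \<Delta> k z x y \<and>
    superregular \<Phi> \<Delta> K y x \<and>
    (\<forall>m\<in>{1..k}. covering_label \<Phi> \<Delta> K (z m) (z (m - 1)) (\<beta> m)) \<longrightarrow>
    (let fs = far_indices \<Phi> \<Delta> K k z \<beta>;
         ns = near_indices \<Phi> \<Delta> K k z \<beta>;
         r\<^sub>f = comp_list (map (\<lambda>m. root_refl (\<beta> m)) fs);
         r\<^sub>n = comp_list (map (\<lambda>m. root_refl (\<beta> m)) ns)
     in \<exists>P\<^sub>f P\<^sub>n.
          list_all2 (\<lambda>m e. near_edge \<Phi> \<Delta> K (z m) (z (m - 1)) (\<beta> m) e) ns P\<^sub>n \<and>
          list_all2 (\<lambda>m e. far_edge \<Phi> \<Delta> K (z m) (z (m - 1)) (\<beta> m) e) (rev fs) P\<^sub>f \<and>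
          pre_digraph.awalk (qbg \<Phi> \<Delta>) (w \<circ> v) P\<^sub>n (w \<circ> v \<circ> r\<^sub>n) \<and>
          pre_digraph.awalk (qbg \<Phi> \<Delta>) (v \<circ> r\<^sub>f) P\<^sub>f v \<and>
          x = w \<circ> v \<circ> r\<^sub>n \<circ> inv (v \<circ> r\<^sub>f) \<circ>
              transl ((v \<circ> r\<^sub>f) (\<mu> + path_weight \<Phi> \<Delta> P\<^sub>n + path_weight \<Phi> \<Delta> P\<^sub>f)))"
proof (intro exI[of _ "pairing_bound \<Phi> + 1"] allI impI, goal_cases)
  case (1 K \<Delta> x y w v \<mu> k z \<beta>)
  let ?F = "far_indices \<Phi> \<Delta> K k z \<beta>" and ?N = "near_indices \<Phi> \<Delta> K k z \<beta>"
  have K: "K > pairing_bound \<Phi>"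
    using 1(1) by simp
  have simple: "simple_roots \<Phi> \<Delta>" and wv: "w \<in> finite_weyl \<Phi>" "v \<in> finite_weyl \<Phi>"
    and anti: "antidominant \<Delta> \<mu>" and ends: "z 0 = w \<circ> transl (v \<mu>)" "z k = x"
    and labels: "\<forall>m\<in>{1..k}. covering_label \<Phi> \<Delta> K (z m) (z (m - 1)) (\<beta> m)"
    using 1(2) by (auto simp: saturated_chain_def)
  have words: "map (\<lambda>m. root_refl (\<beta> m)) is = map root_refl (map \<beta> is)" for "is"
    by simp
  obtain w\<^sub>k v\<^sub>k P\<^sub>f P\<^sub>n where res: "v\<^sub>k \<in> finite_weyl \<Phi>"
    "v\<^sub>k = v \<circ> word (map \<beta> ?F)" "w\<^sub>k \<circ> v\<^sub>k = w \<circ> v \<circ> word (map \<beta> ?N)"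
    "z k = w\<^sub>k \<circ> transl (v\<^sub>k (\<mu> + path_weight \<Phi> \<Delta> P\<^sub>n + path_weight \<Phi> \<Delta> P\<^sub>f))"
    "list_all2 (\<lambda>m e. near_edge \<Phi> \<Delta> K (z m) (z (m - 1)) (\<beta> m) e) ?N P\<^sub>n"
    "list_all2 (\<lambda>m e. far_edge \<Phi> \<Delta> K (z m) (z (m - 1)) (\<beta> m) e) (rev ?F) P\<^sub>f"
    "pre_digraph.awalk (qbg \<Phi> \<Delta>) (w \<circ> v) P\<^sub>n (w\<^sub>k \<circ> v\<^sub>k)"
    "pre_digraph.awalk (qbg \<Phi> \<Delta>) v\<^sub>k P\<^sub>f v"
    using chain_walks[OF assms(1,3) simple K wv anti ends(1) labels] by blast
  have "w\<^sub>k = w\<^sub>k \<circ> v\<^sub>k \<circ> inv v\<^sub>k"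
    using finite_weyl_comp_inv[OF res(1)] by (simp only: o_assoc[symmetric] comp_id)
  then have x: "x = w\<^sub>k \<circ> v\<^sub>k \<circ> inv v\<^sub>k \<circ>
      transl (v\<^sub>k (\<mu> + path_weight \<Phi> \<Delta> P\<^sub>n + path_weight \<Phi> \<Delta> P\<^sub>f))"
    using res(4) ends(2) by simp
  show ?case
    unfolding Let_def words res(2,3)[symmetric]
    using res(5-8) x by blast
qed

end
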